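(* Let $S,P$ be disjoint finite sets, $\mathcal{V}_{SP}$ a vector space on $S\uplus P$, and $\mathcal{K}_P=\mathcal{V}_P+L_P$ a generalized number lattice on $P$ with $\mathcal{V}_P$ a vector space, $L_P$ a number lattice and $\mathcal{V}_P\cap L_P=\{0_P\}$. Let $\mathcal{K}_S:=\mathcal{V}_{SP}\leftrightarrow\mathcal{K}_P$ and $\mathcal{V}_S:=\mathcal{V}_{SP}\leftrightarrow\mathcal{V}_P$. Suppose $\mathcal{V}_{SP}\times P\subseteq\mathcal{V}_P$ and $\mathcal{V}_{SP}\circ P\supseteq\mathcal{K}_P$. Then: 1. $\mathcal{V}_{SP}\leftrightarrow\mathcal{K}_S=\mathcal{K}_P$ and $\mathcal{V}_{SP}\leftrightarrow\mathcal{V}_S=\mathcal{V}_P$. 2. Let $B_P$ be a basis matrix for $L_P$ with rows $x_{1P},\dots,x_{nP}$. Then there exist vectors $\hat x_{iS}$, $i=1,\dots,n$, with $(\hat x_{iS},x_{iP})\in\mathcal{V}_{SP}$; and for any such choice, the matrix $B_S$ whose $i$-th row is $\hat x_{iS}$ has linearly independent rows and is a basis matrix for a number lattice $L_S\subseteq\mathcal{V}_{SP}\leftrightarrow L_P$ such that $L_P\subseteq\mathcal{V}_{SP}\leftrightarrow L_S$, $\mathcal{V}_S\cap L_S=\{0_S\}$ and $\mathcal{K}_S=\mathcal{V}_S+L_S$. 3. Let $L'_S$ be a number lattice with $L'_S\subseteq\mathcal{V}_{SP}\leftrightarrow L_P$, $L'_S\cap\mathcal{V}_S=\{0_S\}$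 and $L_P\subseteq\mathcal{V}_{SP}\leftrightarrow L'_S$. Then (a) for every $x_P\in L_P$ with $x_P\neq 0_P$ there is a unique $\hat x_S\in L'_S$ with $(\hat x_S,x_P)\in\mathcal{V}_{SP}$, and $\hat x_S\ne 0_S$; (b) if $B_P$ is a basis matrix for $L_P$ with rows $x_{1P},\dots,x_{nP}$ and $\hat x_{iS}\in L'_S$ satisfy $(\hat x_{iS},x_{iP})\in\mathcal{V}_{SP}$, then the matrix $B_S$ with $i$-th row $\hat x_{iS}$ is a basis matrix for $L'_S$; (c) $\mathcal{K}_S=L'_S+\mathcal{V}_S$.
   Context: All vectors are over $\mathbb{Q}$; a vector on a finite set $X$ is a function $X\to\mathbb{Q}$, $0_X$ the zero vector, and $(f_X,g_Y)$ the vector on $X\uplus Y$ formed from $f_X,g_Y$. A number lattice is the set of integer linear combinations of finitely many vectors; a basis matrix of a number lattice is a matrix with linearly independent rows generating it by integer combinations. A generalized number lattice is a sum $L+\mathcal{V}$ of a number lattice and a vector space. Restriction: $\mathcal{K}_{SP}\circ P=\{f_P:\exists f_S,(f_S,f_P)\in\mathcal{K}_{SP}\}$; contraction: $\mathcal{K}_{SP}\times P=\{f_P:(0_S,f_P)\in\mathcal{K}_{SP}\}$. Matched composition: for $\mathcal{K}_{SP}$ on $S\uplus P$ and $\mathcal{K}_P$ on $P$, $\mathcal{K}_{SP}\leftrightarrow\mathcal{K}_P=\{f_S:\exists h_P\in\mathcal{K}_P,\ (f_S,h_P)\in\mathcal{K}_{SP}\}$, and symmetrically $\mathcal{K}_{SP}\leftrightarrow\mathcal{K}_S=\{f_P:\exists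 h_S\in\mathcal{K}_S,(h_S,f_P)\in\mathcal{K}_{SP}\}$. *)

theory Defs
  imports Complex_Main "HOL-Library.Function_Algebras" "HOL-Library.Set_Algebras"
begin

text \<open>
  A vector on a set X is represented by its extension by zero to the ambient type, so that
  addition and the zero vector are those of the function space. The empty set is allowed as
  index set.
\<close>

definition vec_on :: "'a set \<Rightarrow> ('a \<Rightarrow> rat) set" where
  "vec_on X = {f. \<forall>x. x \<notin> X \<longrightarrow> f x = 0}"

definition vscale :: "rat \<Rightarrow> ('a \<Rightarrow> rat) \<Rightarrow> 'a \<Rightarrow> rat" where
  "vscale c f = (\<lambda>x. c * f x)"

global_interpretation rvec: vector_space "vscale :: rat \<Rightarrow> ('a \<Rightarrow> rat) \<Rightarrow> 'a \<Rightarrow> rat"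
  by unfold_locales (auto simp: vscale_def fun_eq_iff algebra_simps)

definition vector_space_on :: "'a set \<Rightarrow> ('a \<Rightarrow> rat) set \<Rightarrow> bool" where
  "vector_space_on X V \<longleftrightarrow> V \<subseteq> vec_on X \<and> rvec.subspace V"

text \<open>A matrix with columns indexed by X is the list of its rows.\<close>

definition int_combs :: "('a \<Rightarrow> rat) list \<Rightarrow> ('a \<Rightarrow> rat) set" where
  "int_combs B = {\<Sum>i<length B. vscale (of_int (c i)) (B ! i) | c :: nat \<Rightarrow> int. True}"

definition number_lattice_on :: "'a set \<Rightarrow> ('a \<Rightarrow> rat) set \<Rightarrow> bool" where
  "number_lattice_on X L \<longleftrightarrow> (\<exists>B. set B \<subseteq> vec_on X \<and> L = int_combs B)"

text \<open>Distinctness is required because the rows must be independent as a family.\<close>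

definition lin_indep_rows :: "('a \<Rightarrow> rat) list \<Rightarrow> bool" where
  "lin_indep_rows B \<longleftrightarrow> distinct B \<and> rvec.independent (set B)"

definition basis_matrix_on :: "'a set \<Rightarrow> ('a \<Rightarrow> rat) list \<Rightarrow> ('a \<Rightarrow> rat) set \<Rightarrow> bool" where
  "basis_matrix_on X B L \<longleftrightarrow> set B \<subseteq> vec_on X \<and> lin_indep_rows B \<and> L = int_combs B"

text \<open>For disjoint X and Y, the vector (f, g) on their union, given f on X and g on Y.\<close>

definition vjoin :: "'a set \<Rightarrow> 'a set \<Rightarrow> ('a \<Rightarrow> rat) \<Rightarrow> ('a \<Rightarrow> rat) \<Rightarrow> 'a \<Rightarrow> rat" where
  "vjoin X Y f g = (\<lambda>x. if x \<in> X then f x else if x \<in> Y then g x else 0)"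

text \<open>
  Below K is a collection of vectors on the disjoint union of X and Y. Since vjoin is symmetric
  for disjoint index sets, exchanging X and Y gives the symmetric versions of these operations.
\<close>

definition vrestriction ::
  "'a set \<Rightarrow> 'a set \<Rightarrow> ('a \<Rightarrow> rat) set \<Rightarrow> ('a \<Rightarrow> rat) set" where
  "vrestriction X Y K = {g \<in> vec_on Y. \<exists>f \<in> vec_on X. vjoin X Y f g \<in> K}"

definition vcontraction ::
  "'a set \<Rightarrow> 'a set \<Rightarrow> ('a \<Rightarrow> rat) set \<Rightarrow> ('a \<Rightarrow> rat) set" where
  "vcontraction X Y K = {g \<in> vec_on Y. vjoin X Y 0 g \<in> K}"

text \<open>The matched composition of K with a collection of vectors on Y; the result lives on X.\<close>

definition matched_comp ::
  "'a set \<Rightarrow> 'a set \<Rightarrow> ('a \<Rightarrow> rat) set \<Rightarrow> ('a \<Rightarrow> rat) set \<Rightarrow> ('a \<Rightarrow> rat) set" where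
  "matched_comp X Y K KY = {f \<in> vec_on X. \<exists>h \<in> KY. vjoin X Y f h \<in> K}"

end

theory Submission
  imports Defs
begin

text \<open>
  Call f on S and g on P linked if (f, g) lies in V_SP. Linkage is a linear relation. A vector
  linked to 0 on S lies in V_P, and one linked to 0 on P lies in V_S, so linkage identifies K_S
  modulo V_S with K_P modulo V_P. As L_P and V_P meet trivially, L_P is a transversal
  of K_P modulo V_P, and L_S is a transversal of K_S modulo V_S that is linked to it.
  Independence only has to be tested on integer coefficients, after clearing
  denominators, and an integer combination of the rows of B_P that lies in V_P vanishes.
\<close>

section \<open>Integer combinations and independence of rows\<close>

text \<open>Distinctness makes indexing a bijection onto \<open>set B\<close>, so independence of
  the set and of the family agree; two equal rows would satisfy the relation with coefficients 1 and
  -1.\<close>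

lemma lin_indep_rows_iff:
  "lin_indep_rows B \<longleftrightarrow>
    (\<forall>c. (\<Sum>i<length B. vscale (c i) (B ! i)) = 0 \<longrightarrow> (\<forall>i<length B. c i = 0))"
  (is "_ \<longleftrightarrow> ?R")
proof
  assume "lin_indep_rows B"
  then have d: "distinct B" and ind: "rvec.independent (set B)"
    by (auto simp: lin_indep_rows_def)
  have bij: "bij_betw ((!) B) {..<length B} (set B)"
    using d by (rule bij_betw_nth) auto
  show ?R
  proof (intro allI impI)
    fix c i
    assume 0: "(\<Sum>i<length B. vscale (c i) (B ! i)) = 0" and i: "i < length B"
    \<comment> \<open>Independence of a set needs scalars indexed by vectors, so \<open>c\<close> is
      carried over along the inverse of indexing.\<close>
    define u where "u = c \<circ> the_inv_into {..<length B} ((!) B)"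
    have u: "u (B ! j) = c j" if "j < length B" for j
      using that bij by (simp add: u_def bij_betw_def the_inv_into_f_f)
    have "(\<Sum>v\<in>set B. vscale (u v) v) = (\<Sum>i<length B. vscale (u (B ! i)) (B ! i))"
      using sum.reindex_bij_betw[OF bij, of "\<lambda>v. vscale (u v) v"] by simp
    also have "\<dots> = 0"
      using 0 u by simp
    finally have "u (B ! i) = 0"
      using rvec.independentD[OF ind finite_set order_refl] i by simp
    then show "c i = 0"
      using u i by simp
  qed
next
  assume R: ?R
  have d: "distinct B"
    unfolding distinct_conv_nth
  proof (intro allI impI notI)
    fix i j
    assume ij: "i < length B" "j < length B" "i \<noteq> j" "B ! i = B ! j"
    define c :: "nat \<Rightarrow> rat" where "c k = (if k = i then 1 else if k = j then -1 else 0)" for k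
    have "(\<Sum>k<length B. vscale (c k) (B ! k)) = (\<Sum>k\<in>{i, j}. vscale (c k) (B ! k))"
      using ij by (intro sum.mono_neutral_right) (auto simp: c_def)
    also have "\<dots> = 0"
      using ij by (simp add: c_def)
    finally have "c i = 0"
      using R ij by blast
    then show False
      by (simp add: c_def)
  qed
  have bij: "bij_betw ((!) B) {..<length B} (set B)"
    using d by (rule bij_betw_nth) auto
  have "rvec.independent (set B)"
  proof (rule rvec.independent_if_scalars_zero[OF finite_set])
    fix u v
    assume 0: "(\<Sum>x\<in>set B. vscale (u x) x) = 0" and v: "v \<in> set B"
    have "(\<Sum>i<length B. vscale (u (B ! i)) (B ! i)) = 0"
      using sum.reindex_bij_betw[OF bij, of "\<lambda>v. vscale (u v) v"] 0 by simp
    then have "\<forall>i<length B. u (B ! i) = 0"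
      using R[rule_format, of "\<lambda>i. u (B ! i)"] by simp
    then show "u v = 0"
      using v by (auto simp: in_set_conv_nth)
  qed
  with d show "lin_indep_rows B"
    by (simp add: lin_indep_rows_def)
qed

lemma clear_denominators:
  fixes c :: "nat \<Rightarrow> rat"
  shows "\<exists>D :: int. D \<noteq> 0 \<and> (\<exists>k :: nat \<Rightarrow> int. \<forall>i<n. of_int D * c i = of_int (k i))"
proof (induction n)
  case 0
  show ?case
    by (intro exI[of _ 1]) simp
next
  case (Suc n)
  then obtain D k where D: "D \<noteq> 0" "\<forall>i<n. of_int D * c i = of_int (k i :: int)"
    by blast
  obtain a b where ab: "c n = of_int a / of_int b" "b > 0"
    by (cases "c n" rule: Rat_cases) (auto simp: Fract_of_int_quotient)
  \<comment> \<open>\<open>b * D\<close> is the new common denominator: the old numerators gain the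
    factor \<open>b\<close>, and the new one is \<open>a\<close> times the old
    \<open>D\<close>.\<close>
  have "of_int (b * D) * c i = of_int (if i = n then D * a else b * k i)" if "i < Suc n" for i
    using that D ab by (auto simp: less_Suc_eq)
  then show ?case
    using D ab by (intro exI[of _ "b * D"] conjI exI[of _ "\<lambda>i. if i = n then D * a else b * k i"]) auto
qed

text \<open>The coefficients are explicit so that one \<open>c\<close> can be applied to two
  matrices whose rows are linked.\<close>

definition int_comb :: "(nat \<Rightarrow> int) \<Rightarrow> ('a \<Rightarrow> rat) list \<Rightarrow> 'a \<Rightarrow> rat" where
  "int_comb c B = (\<Sum>i<length B. vscale (of_int (c i)) (B ! i))"

lemma int_combs_eq_range: "int_combs B = range (\<lambda>c. int_comb c B)"
  by (auto simp: int_combs_def int_comb_def)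

lemma int_comb_in_int_combs: "int_comb c B \<in> int_combs B"
  by (simp add: int_combs_eq_range)

lemma int_comb_zero: "(\<And>i. i < length B \<Longrightarrow> c i = 0) \<Longrightarrow> int_comb c B = 0"
  by (simp add: int_comb_def)

text \<open>Multiplying a rational relation by a nonzero common denominator makes it integral. Only
  integer combinations of the rows stay in the lattice, where the trivial intersection with the
  vector space can be applied.\<close>

lemma lin_indep_rows_iff_int:
  "lin_indep_rows B \<longleftrightarrow> (\<forall>c. int_comb c B = 0 \<longrightarrow> (\<forall>i<length B. c i = 0))"
proof
  assume "lin_indep_rows B"
  then show "\<forall>c. int_comb c B = 0 \<longrightarrow> (\<forall>i<length B. c i = 0)"
    unfolding lin_indep_rows_iff int_comb_def by (metis of_int_eq_0_iff)
next
  assume R: "\<forall>c. int_comb c B = 0 \<longrightarrow> (\<forall>i<length B. c i = 0)"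
  show "lin_indep_rows B"
    unfolding lin_indep_rows_iff
  proof (intro allI impI)
    fix c i
    assume 0: "(\<Sum>i<length B. vscale (c i) (B ! i)) = 0" and i: "i < length B"
    obtain D k where D: "D \<noteq> 0" "\<forall>i<length B. of_int D * c i = of_int (k i :: int)"
      using clear_denominators by blast
    have "int_comb k B = (\<Sum>i<length B. vscale (of_int D) (vscale (c i) (B ! i)))"
      using D by (simp add: int_comb_def)
    also have "\<dots> = vscale (of_int D) 0"
      unfolding 0[symmetric] by (rule rvec.scale_sum_right[symmetric])
    also have "\<dots> = 0"
      by simp
    finally have "k i = 0"
      using R i by blast
    then show "c i = 0"
      using D i by auto
  qed
qed

section \<open>Closure properties of integer combinations\<close>

lemma int_combs_zero: "0 \<in> int_combs B"
  using int_comb_in_int_combs[of "\<lambda>_. 0" B] by (simp add: int_comb_zero)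

lemma int_combs_add: "f \<in> int_combs B \<Longrightarrow> g \<in> int_combs B \<Longrightarrow> f + g \<in> int_combs B"
proof -
  have "int_comb c B + int_comb d B = int_comb (\<lambda>i. c i + d i) B" for c d
    by (simp add: int_comb_def sum.distrib rvec.scale_left_distrib)
  then show "f \<in> int_combs B \<Longrightarrow> g \<in> int_combs B \<Longrightarrow> f + g \<in> int_combs B"
    by (auto simp: int_combs_eq_range)
qed

lemma int_combs_scale: "f \<in> int_combs B \<Longrightarrow> vscale (of_int k) f \<in> int_combs B"
proof -
  have "vscale (of_int k) (int_comb c B) = int_comb (\<lambda>i. k * c i) B" for c
    by (simp add: int_comb_def rvec.scale_sum_right)
  then show "f \<in> int_combs B \<Longrightarrow> vscale (of_int k) f \<in> int_combs B"
    by (auto simp: int_combs_eq_range)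
qed

lemma int_combs_diff: "f \<in> int_combs B \<Longrightarrow> g \<in> int_combs B \<Longrightarrow> f - g \<in> int_combs B"
  using int_combs_add[of f B "vscale (of_int (-1)) g"] int_combs_scale[of g B "-1"] by simp

lemma int_comb_closed:
  assumes "\<And>i. i < length B \<Longrightarrow> B ! i \<in> int_combs A"
  shows "int_comb c B \<in> int_combs A"
proof -
  \<comment> \<open>Partial sums keep \<open>B\<close> fixed during the induction;
    \<open>n \<le> length B\<close> keeps each index within the rows.\<close>
  have "(\<Sum>i<n. vscale (of_int (c i)) (B ! i)) \<in> int_combs A" if "n \<le> length B" for n
    using that
    by (induction n) (simp_all add: int_combs_zero int_combs_add int_combs_scale assms)
  then show ?thesis
    by (simp add: int_comb_def)
qed

lemma subspace_vec_on: "rvec.subspace (vec_on X)"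
  by (auto simp: rvec.subspace_def vec_on_def vscale_def)

lemma int_combs_subset_vec_on: "set B \<subseteq> vec_on X \<Longrightarrow> int_combs B \<subseteq> vec_on X"
  by (auto simp: int_combs_def intro!: rvec.subspace_sum[OF subspace_vec_on]
      rvec.subspace_scale[OF subspace_vec_on])

section \<open>Linked vectors\<close>

text \<open>\<open>vjoin\<close> ignores the values of its arguments off \<open>X\<close> and
  \<open>Y\<close>, so membership in \<open>vec_on\<close> is built in. As a relation, linkage turns
  contraction into the fibre over 0, restriction into the range and matched composition into a
  preimage.\<close>

definition linked :: "'a set \<Rightarrow> 'a set \<Rightarrow> ('a \<Rightarrow> rat) set \<Rightarrow> ('a \<Rightarrow> rat) \<Rightarrow> ('a \<Rightarrow> rat) \<Rightarrow> bool" where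
  "linked X Y K f g \<longleftrightarrow> f \<in> vec_on X \<and> g \<in> vec_on Y \<and> vjoin X Y f g \<in> K"

lemma vjoin_commute: "X \<inter> Y = {} \<Longrightarrow> vjoin X Y f g = vjoin Y X g f"
  by (auto simp: vjoin_def fun_eq_iff)

lemma linked_commute: "X \<inter> Y = {} \<Longrightarrow> linked Y X K g f \<longleftrightarrow> linked X Y K f g"
  using vjoin_commute[of X Y f g] by (auto simp: linked_def)

lemma matched_comp_eq_linked:
  "KY \<subseteq> vec_on Y \<Longrightarrow> matched_comp X Y K KY = {f. \<exists>h\<in>KY. linked X Y K f h}"
  by (auto simp: matched_comp_def linked_def)

lemma vcontraction_eq_linked: "vcontraction X Y K = {g. linked X Y K 0 g}"
  by (auto simp: vcontraction_def linked_def vec_on_def)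

lemma vrestriction_eq_linked: "vrestriction X Y K = {g. \<exists>f. linked X Y K f g}"
  by (auto simp: vrestriction_def linked_def)

context
  fixes X Y :: "'a set" and V :: "('a \<Rightarrow> rat) set"
  assumes V: "rvec.subspace V"
begin

lemma linked_zero: "linked X Y V 0 0"
proof -
  have "vjoin X Y 0 0 = (0 :: 'a \<Rightarrow> rat)"
    by (auto simp: vjoin_def fun_eq_iff)
  then show ?thesis
    using rvec.subspace_0[OF V] by (simp add: linked_def rvec.subspace_0[OF subspace_vec_on])
qed

lemma linked_add: "linked X Y V f g \<Longrightarrow> linked X Y V f' g' \<Longrightarrow> linked X Y V (f + f') (g + g')"
proof -
  have "vjoin X Y (f + f') (g + g') = vjoin X Y f g + vjoin X Y f' g'"
    by (auto simp: vjoin_def fun_eq_iff)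
  then show "linked X Y V f g \<Longrightarrow> linked X Y V f' g' \<Longrightarrow> linked X Y V (f + f') (g + g')"
    by (auto simp: linked_def intro: rvec.subspace_add[OF V] rvec.subspace_add[OF subspace_vec_on])
qed

lemma linked_scale: "linked X Y V f g \<Longrightarrow> linked X Y V (vscale c f) (vscale c g)"
proof -
  have "vjoin X Y (vscale c f) (vscale c g) = vscale c (vjoin X Y f g)"
    by (auto simp: vjoin_def vscale_def fun_eq_iff)
  then show "linked X Y V f g \<Longrightarrow> linked X Y V (vscale c f) (vscale c g)"
    by (auto simp: linked_def intro: rvec.subspace_scale[OF V] rvec.subspace_scale[OF subspace_vec_on])
qed

lemma linked_diff: "linked X Y V f g \<Longrightarrow> linked X Y V f' g' \<Longrightarrow> linked X Y V (f - f') (g - g')"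
  using linked_add[of f g "vscale (-1) f'" "vscale (-1) g'"] linked_scale[of f' g' "-1"] by simp

text \<open>Linkage is a linear relation, so links between rows extend to combinations with the same
  coefficients.\<close>

lemma linked_int_comb:
  assumes "length A = length B" and "\<And>i. i < length B \<Longrightarrow> linked X Y V (A ! i) (B ! i)"
  shows "linked X Y V (int_comb c A) (int_comb c B)"
proof -
  have "linked X Y V (\<Sum>i<n. vscale (of_int (c i)) (A ! i)) (\<Sum>i<n. vscale (of_int (c i)) (B ! i))"
    if "n \<le> length B" for n
    using that by (induction n) (simp_all add: linked_zero linked_add linked_scale assms)
  then show ?thesis
    using assms(1) by (simp add: int_comb_def)
qed

end

text \<open>Two vectors linked to the same \<open>f\<close> differ by a vector linked to 0, which
  lies in \<open>W\<close>, and adding \<open>W\<close> does not leave \<open>K\<close>; the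
  restriction hypothesis gives every vector of \<open>K\<close> a partner. Leaving \<open>K\<close>
  general covers both \<open>K_P\<close> and \<open>V_P\<close>.\<close>

lemma matched_comp_involution:
  assumes V: "rvec.subspace V" and disj: "X \<inter> Y = {}"
    and con: "vcontraction X Y V \<subseteq> W" and res: "K \<subseteq> vrestriction X Y V"
    and closed: "\<And>k w. k \<in> K \<Longrightarrow> w \<in> W \<Longrightarrow> w + k \<in> K"
  shows "matched_comp Y X V (matched_comp X Y V K) = K"
proof -
  have KY: "K \<subseteq> vec_on Y"
    using res by (auto simp: vrestriction_def)
  have "matched_comp X Y V K \<subseteq> vec_on X"
    by (auto simp: matched_comp_def)
  then have eq: "matched_comp Y X V (matched_comp X Y V K) =
      {g. \<exists>f. (\<exists>h\<in>K. linked X Y V f h) \<and> linked X Y V f g}"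
    using KY disj by (auto simp: matched_comp_eq_linked linked_commute[OF disj])
  have "g \<in> K" if "h \<in> K" "linked X Y V f h" "linked X Y V f g" for f g h
  proof -
    have "linked X Y V 0 (g - h)"
      using linked_diff[OF V that(3,2)] by simp
    then have "g - h \<in> W"
      using con by (auto simp: vcontraction_eq_linked)
    from closed[OF that(1) this] show ?thesis
      by simp
  qed
  \<comment> \<open>In the converse inclusion \<open>g\<close> itself serves as \<open>h\<close>, so
    a single partner \<open>f\<close> suffices.\<close>
  moreover have "\<exists>f. linked X Y V f g" if "g \<in> K" for g
    using that res by (auto simp: vrestriction_eq_linked)
  ultimately show ?thesis
    unfolding eq by blast
qed

text \<open>If \<open>f\<close> is linked to \<open>w + l\<close>, subtracting a partner of
  \<open>l\<close> in \<open>LX\<close> leaves a vector linked to \<open>w\<close>; conversely,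
  links are added. The inclusions relating \<open>LX\<close> and \<open>LY\<close> supply the
  partners in the two directions.\<close>

lemma matched_comp_sum:
  assumes V: "rvec.subspace V" and disj: "X \<inter> Y = {}"
    and W: "W \<subseteq> vec_on Y" and LY: "LY \<subseteq> vec_on Y" and LX: "LX \<subseteq> matched_comp X Y V LY"
    and LY': "LY \<subseteq> matched_comp Y X V LX"
  shows "matched_comp X Y V (W + LY) = matched_comp X Y V W + LX"
proof -
  have sub: "W + LY \<subseteq> vec_on Y"
    using W LY rvec.subspace_add[OF subspace_vec_on] by (blast elim: set_plus_elim)
  have LXv: "LX \<subseteq> vec_on X"
    using LX by (auto simp: matched_comp_def)
  show ?thesis
  proof (intro subset_antisym subsetI)
    fix f
    assume "f \<in> matched_comp X Y V (W + LY)"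
    then obtain w l where wl: "w \<in> W" "l \<in> LY" "linked X Y V f (w + l)"
      using sub by (auto simp: matched_comp_eq_linked elim!: set_plus_elim)
    then obtain f' where f': "f' \<in> LX" "linked X Y V f' l"
      using LY' LXv disj by (auto simp: matched_comp_eq_linked linked_commute[OF disj])
    have "linked X Y V (f - f') w"
      using linked_diff[OF V wl(3) f'(2)] by simp
    then have "f - f' \<in> matched_comp X Y V W"
      using W wl by (auto simp: matched_comp_eq_linked)
    from set_plus_intro[OF this f'(1)] show "f \<in> matched_comp X Y V W + LX"
      by simp
  next
    fix f
    assume "f \<in> matched_comp X Y V W + LX"
    then obtain g g' w l where "f = g + g'" "w \<in> W" "linked X Y V g w" "l \<in> LY" "linked X Y V g' l"
      using LX W LY by (fastforce simp: matched_comp_eq_linked elim!: set_plus_elim)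
    then show "f \<in> matched_comp X Y V (W + LY)"
      using sub by (auto simp: matched_comp_eq_linked intro!: bexI[of _ "w + l"] set_plus_intro linked_add[OF V])
  qed
qed

text \<open>The vector \<open>int_comb c A\<close> is linked to \<open>w\<close> and to
  \<open>int_comb c B\<close>, so the latter differs from \<open>w\<close> by an element of the
  contraction, hence lies in \<open>W\<close> and vanishes. The case \<open>w = 0\<close> gives
  independence of \<open>A\<close>, general \<open>w\<close> the trivial intersection with
  \<open>V_S\<close>.\<close>

lemma int_comb_vanishes_if_linked:
  assumes V: "rvec.subspace V" and W: "rvec.subspace W"
    and con: "vcontraction X Y V \<subseteq> W" and triv: "W \<inter> int_combs B = {0}"
    and len: "length A = length B" and AB: "\<And>i. i < length B \<Longrightarrow> linked X Y V (A ! i) (B ! i)"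
    and w: "w \<in> W" "linked X Y V (int_comb c A) w"
  shows "int_comb c B = 0"
proof -
  have "linked X Y V 0 (int_comb c B - w)"
    using linked_diff[OF V linked_int_comb[OF V len AB, of c] w(2)] by simp
  then have "int_comb c B - w \<in> W"
    using con by (auto simp: vcontraction_eq_linked)
  from rvec.subspace_add[OF W this w(1)] have "int_comb c B \<in> W"
    by simp
  then show ?thesis
    using triv int_comb_in_int_combs[of c B] by blast
qed

lemma lin_indep_rows_linked:
  assumes V: "rvec.subspace V" and W: "rvec.subspace W"
    and con: "vcontraction X Y V \<subseteq> W" and triv: "W \<inter> int_combs B = {0}"
    and len: "length A = length B" and AB: "\<And>i. i < length B \<Longrightarrow> linked X Y V (A ! i) (B ! i)"
    and B: "lin_indep_rows B"
  shows "lin_indep_rows A"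
  unfolding lin_indep_rows_iff_int
proof (intro allI impI)
  fix c i
  assume 0: "int_comb c A = 0" and i: "i < length A"
  have "int_comb c B = 0"
    using int_comb_vanishes_if_linked[OF V W con triv len AB rvec.subspace_0[OF W]]
    using linked_zero[OF V] by (simp add: 0)
  then show "c i = 0"
    using B i len by (auto simp: lin_indep_rows_iff_int)
qed

theorem theorem4:
  fixes S P :: "'a set"
    and V_SP V_P L_P K_P K_S V_S :: "('a \<Rightarrow> rat) set"
  assumes "finite S" and "finite P" and "S \<inter> P = {}"
    and "vector_space_on (S \<union> P) V_SP"
    and "vector_space_on P V_P"
    and "number_lattice_on P L_P"
    and "V_P \<inter> L_P = {0}"
    and "K_P = V_P + L_P"
    and "K_S = matched_comp S P V_SP K_P"
    and "V_S = matched_comp S P V_SP V_P"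
    and "vcontraction S P V_SP \<subseteq> V_P"
    and "K_P \<subseteq> vrestriction S P V_SP"
  shows
    "(matched_comp P S V_SP K_S = K_P \<and> matched_comp P S V_SP V_S = V_P) \<and>
     (\<forall>B_P. basis_matrix_on P B_P L_P \<longrightarrow>
        (\<exists>B_S. length B_S = length B_P \<and>
           (\<forall>i<length B_P. B_S ! i \<in> vec_on S \<and> vjoin S P (B_S ! i) (B_P ! i) \<in> V_SP)) \<and>
        (\<forall>B_S. length B_S = length B_P \<and>
           (\<forall>i<length B_P. B_S ! i \<in> vec_on S \<and> vjoin S P (B_S ! i) (B_P ! i) \<in> V_SP) \<longrightarrow>
           lin_indep_rows B_S \<and>
           (\<exists>L_S. number_lattice_on S L_S \<and> basis_matrix_on S B_S L_S \<and>
              L_S \<subseteq> matched_comp S P V_SP L_P \<and>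
              L_P \<subseteq> matched_comp P S V_SP L_S \<and>
              V_S \<inter> L_S = {0} \<and>
              K_S = V_S + L_S))) \<and>
     (\<forall>L'_S. number_lattice_on S L'_S \<and>
        L'_S \<subseteq> matched_comp S P V_SP L_P \<and>
        L'_S \<inter> V_S = {0} \<and>
        L_P \<subseteq> matched_comp P S V_SP L'_S \<longrightarrow>
        (\<forall>x_P \<in> L_P. x_P \<noteq> 0 \<longrightarrow>
           (\<exists>!x_S. x_S \<in> L'_S \<and> vjoin S P x_S x_P \<in> V_SP) \<and>
           (\<forall>x_S \<in> L'_S. vjoin S P x_S x_P \<in> V_SP \<longrightarrow> x_S \<noteq> 0)) \<and>
        (\<forall>B_P B_S. basis_matrix_on P B_P L_P \<and> length B_S = length B_P \<and>
           (\<forall>i<length B_P. B_S ! i \<in> L'_S \<and> vjoin S P (B_S ! i) (B_P ! i) \<in> V_SP) \<longrightarrow>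
           basis_matrix_on S B_S L'_S) \<and>
        K_S = L'_S + V_S)"
proof -
  have V: "rvec.subspace V_SP"
    using assms(4) by (simp add: vector_space_on_def)
  have W: "rvec.subspace V_P" and WP: "V_P \<subseteq> vec_on P"
    using assms(5) by (auto simp: vector_space_on_def)
  have LP: "L_P \<subseteq> vec_on P"
    using assms(6) int_combs_subset_vec_on by (auto simp: number_lattice_on_def)
  have LP0: "0 \<in> L_P"
    using assms(7) by blast
  note disj = assms(3) and triv = assms(7) and con = assms(11)
  have VK: "V_P \<subseteq> K_P" and LK: "L_P \<subseteq> K_P"
    using LP0 rvec.subspace_0[OF W] set_plus_intro[of _ V_P 0 L_P] set_plus_intro[of 0 V_P _ L_P]
    by (auto simp: assms(8))
  have lift: "\<exists>f. linked S P V_SP f g" if "g \<in> K_P" for g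
    using that assms(12) by (auto simp: vrestriction_eq_linked)
  have VS: "V_S = {f. \<exists>h\<in>V_P. linked S P V_SP f h}"
    using WP by (simp add: assms(10) matched_comp_eq_linked)
  have link: "linked S P V_SP f g \<longleftrightarrow> f \<in> vec_on S \<and> vjoin S P f g \<in> V_SP" if "g \<in> L_P" for f g
    using that LP by (auto simp: linked_def)

  \<comment> \<open>Recovering \<open>K_P\<close> and \<open>V_P\<close> from their
    compositions\<close>
  have "matched_comp P S V_SP K_S = K_P"
    unfolding assms(9)
  proof (rule matched_comp_involution[OF V disj con assms(12)])
    fix k w
    assume "k \<in> K_P" and w: "w \<in> V_P"
    then obtain v l where "k = v + l" "v \<in> V_P" "l \<in> L_P"
      by (auto simp: assms(8) elim!: set_plus_elim)
    \<comment> \<open>The vector \<open>w\<close> is absorbed by the summand \<open>v\<close> of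
      \<open>k\<close>.\<close>
    then show "w + k \<in> K_P"
      using set_plus_intro[OF rvec.subspace_add[OF W w, of v], of l L_P]
      by (simp add: assms(8) add.assoc)
  qed
  moreover have "matched_comp P S V_SP V_S = V_P"
    unfolding assms(10)
    \<comment> \<open>\<open>V_P \<subseteq> K_P\<close> brings \<open>V_P\<close> under the
      restriction hypothesis, and closure is that of a subspace.\<close>
    using VK assms(12) by (intro matched_comp_involution[OF V disj con])
      (auto intro: rvec.subspace_add[OF W])
  ultimately have part1: "matched_comp P S V_SP K_S = K_P \<and> matched_comp P S V_SP V_S = V_P" ..

  \<comment> \<open>The lattice on \<open>S\<close> generated by linked rows\<close>
  have rows_in_LP: "B ! i \<in> L_P" if "basis_matrix_on P B L_P" "i < length B" for B i
  proof -
    \<comment> \<open>Row \<open>i\<close> is the combination with coefficient 1 at \<open>i\<close>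
      and 0 elsewhere.\<close>
    have "int_comb (\<lambda>j. if j = i then 1 else 0) B = (\<Sum>j<length B. if j = i then B ! j else 0)"
      unfolding int_comb_def by (intro sum.cong) auto
    also have "\<dots> = B ! i"
      using that(2) by simp
    finally show ?thesis
      using that(1) int_comb_in_int_combs[of _ B] by (metis basis_matrix_on_def)
  qed

  have exists: "\<exists>B_S. length B_S = length B \<and>
      (\<forall>i<length B. B_S ! i \<in> vec_on S \<and> vjoin S P (B_S ! i) (B ! i) \<in> V_SP)"
    if B: "basis_matrix_on P B L_P" for B
  proof -
    have "\<forall>i<length B. \<exists>f. linked S P V_SP f (B ! i)"
      using lift rows_in_LP[OF B] LK by blast
    then obtain F where "\<forall>i<length B. linked S P V_SP (F i) (B ! i)"
      by metis
    then show ?thesis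
      by (intro exI[of _ "map F [0..<length B]"]) (auto simp: linked_def)
  qed

  have part2: "lin_indep_rows A \<and>
      (\<exists>L_S. number_lattice_on S L_S \<and> basis_matrix_on S A L_S \<and>
        L_S \<subseteq> matched_comp S P V_SP L_P \<and> L_P \<subseteq> matched_comp P S V_SP L_S \<and>
        V_S \<inter> L_S = {0} \<and> K_S = V_S + L_S)"
    if B: "basis_matrix_on P B L_P" and len: "length A = length B"
      and A: "\<forall>i<length B. A ! i \<in> vec_on S \<and> vjoin S P (A ! i) (B ! i) \<in> V_SP" for A B
  proof -
    have LB: "L_P = int_combs B" and indB: "lin_indep_rows B"
      using B by (auto simp: basis_matrix_on_def)
    note triv' = triv[unfolded LB]
    have AB: "\<And>i. i < length B \<Longrightarrow> linked S P V_SP (A ! i) (B ! i)"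
      using A link rows_in_LP[OF B] by blast
    have indA: "lin_indep_rows A"
      by (rule lin_indep_rows_linked[OF V W con triv' len AB indB])
    have setA: "set A \<subseteq> vec_on S"
      using A len by (auto simp: in_set_conv_nth)
    have comb: "linked S P V_SP (int_comb c A) (int_comb c B)" for c
      by (rule linked_int_comb[OF V len AB])
    \<comment> \<open>Equal coefficients on \<open>A\<close> and \<open>B\<close> pair every element
      of either lattice with a linked one in the other, which gives both inclusions.\<close>
    have sub1: "int_combs A \<subseteq> matched_comp S P V_SP L_P"
      using comb LP by (auto simp: matched_comp_eq_linked LB int_combs_eq_range)
    have sub2: "L_P \<subseteq> matched_comp P S V_SP (int_combs A)"
      using comb disj int_combs_subset_vec_on[OF setA]
      by (auto simp: matched_comp_eq_linked LB int_combs_eq_range linked_commute[OF disj])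
    \<comment> \<open>Such an \<open>f\<close> is linked to some \<open>w\<close> in
      \<open>V_P\<close>, so the combination of \<open>B\<close> with the same coefficients
      vanishes; independence of \<open>B\<close> kills the coefficients and with them
      \<open>f\<close>.\<close>
    have "f = 0" if f: "f \<in> V_S" "f \<in> int_combs A" for f
    proof -
      obtain c where c: "f = int_comb c A"
        using f by (auto simp: int_combs_eq_range)
      then obtain w where "w \<in> V_P" "linked S P V_SP (int_comb c A) w"
        using f VS by auto
      then have "int_comb c B = 0"
        using int_comb_vanishes_if_linked[OF V W con triv' len] AB by blast
      then have "\<forall>i<length B. c i = 0"
        using indB by (auto simp: lin_indep_rows_iff_int)
      then show ?thesis
        using len by (simp add: c int_comb_zero)
    qed
    moreover have "0 \<in> V_S"
      using VS linked_zero[OF V] rvec.subspace_0[OF W] by blast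
    ultimately have "V_S \<inter> int_combs A = {0}"
      using int_combs_zero by blast
    moreover have "K_S = V_S + int_combs A"
      unfolding assms(8-10) by (rule matched_comp_sum[OF V disj WP LP sub1 sub2])
    ultimately show ?thesis
      using indA setA sub1 sub2
      by (auto simp: basis_matrix_on_def number_lattice_on_def)
  qed

  \<comment> \<open>Arbitrary lattices on \<open>S\<close> that correspond to
    \<open>L_P\<close>\<close>
  have part3: "(\<forall>x_P \<in> L_P. x_P \<noteq> 0 \<longrightarrow>
           (\<exists>!x_S. x_S \<in> L \<and> vjoin S P x_S x_P \<in> V_SP) \<and>
           (\<forall>x_S \<in> L. vjoin S P x_S x_P \<in> V_SP \<longrightarrow> x_S \<noteq> 0)) \<and>
        (\<forall>B_P B_S. basis_matrix_on P B_P L_P \<and> length B_S = length B_P \<and>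
           (\<forall>i<length B_P. B_S ! i \<in> L \<and> vjoin S P (B_S ! i) (B_P ! i) \<in> V_SP) \<longrightarrow>
           basis_matrix_on S B_S L) \<and>
        K_S = L + V_S"
    if lat: "number_lattice_on S L" and sub1: "L \<subseteq> matched_comp S P V_SP L_P"
      and triv': "L \<inter> V_S = {0}" and sub2: "L_P \<subseteq> matched_comp P S V_SP L" for L
  proof -
    \<comment> \<open>\<open>C\<close> need not be a basis; it shows that \<open>L\<close> lies on
      \<open>S\<close> and is closed under integer combinations.\<close>
    obtain C where C: "set C \<subseteq> vec_on S" "L = int_combs C"
      using lat by (auto simp: number_lattice_on_def)
    have LS: "L \<subseteq> vec_on S"
      using int_combs_subset_vec_on C by blast
    have link': "linked S P V_SP f g \<longleftrightarrow> vjoin S P f g \<in> V_SP" if "f \<in> L" "g \<in> L_P" for f g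
      using that LS LP by (auto simp: linked_def)
    \<comment> \<open>Two partners of \<open>g\<close> differ by a vector linked to 0, which lies in
      \<open>V_S\<close> as well as in \<open>L\<close>.\<close>
    have uniq: "f = f'" if f: "f \<in> L" "f' \<in> L" "linked S P V_SP f g" "linked S P V_SP f' g" for f f' g
    proof -
      have "linked S P V_SP (f - f') 0"
        using linked_diff[OF V f(3,4)] by simp
      then have "f - f' \<in> V_S"
        using VS rvec.subspace_0[OF W] by blast
      moreover have "f - f' \<in> L"
        using f C int_combs_diff by blast
      ultimately show ?thesis
        using triv' by force
    qed
    have ex: "\<exists>f\<in>L. linked S P V_SP f g" if "g \<in> L_P" for g
      using that sub2 LS disj by (auto simp: matched_comp_eq_linked linked_commute[OF disj])
    \<comment> \<open>A vector linked to 0 lies in the contraction, hence in \<open>V_P\<close>,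
      which meets \<open>L_P\<close> only in 0. So a nonzero \<open>x_P\<close> has no zero
      partner.\<close>
    have nz: "g = 0" if "g \<in> L_P" "linked S P V_SP 0 g" for g
      using that con triv by (auto simp: vcontraction_eq_linked)
    have a: "(\<exists>!f. f \<in> L \<and> vjoin S P f g \<in> V_SP) \<and> (\<forall>f\<in>L. vjoin S P f g \<in> V_SP \<longrightarrow> f \<noteq> 0)"
      if "g \<in> L_P" "g \<noteq> 0" for g
    proof (intro conjI ballI impI)
      show "\<exists>!f. f \<in> L \<and> vjoin S P f g \<in> V_SP"
        using ex[OF that(1)] uniq[of _ _ g] link'[OF _ that(1)] by metis
      show "f \<noteq> 0" if "f \<in> L" "vjoin S P f g \<in> V_SP" for f
        using that link' nz \<open>g \<in> L_P\<close> \<open>g \<noteq> 0\<close> by blast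
    qed
    have b: "basis_matrix_on S A L"
      if B: "basis_matrix_on P B L_P" and len: "length A = length B"
        and A: "\<forall>i<length B. A ! i \<in> L \<and> vjoin S P (A ! i) (B ! i) \<in> V_SP" for A B
    proof -
      \<comment> \<open>The rows of \<open>A\<close> are one of the choices already treated, so
        their independence is inherited from there.\<close>
      have ind: "lin_indep_rows A"
        using part2[OF B len] A LS by blast
      have AB: "\<And>i. i < length B \<Longrightarrow> linked S P V_SP (A ! i) (B ! i)"
        using A link' rows_in_LP[OF B] by blast
      have closed: "int_comb c A \<in> L" for c
        using int_comb_closed[of A C c] A len C by auto
      \<comment> \<open>\<open>f\<close> has a partner \<open>g\<close> in \<open>L_P\<close>; the
        coefficients of \<open>g\<close> over \<open>B\<close> give a combination of
        \<open>A\<close> in \<open>L\<close> with the same partner, and uniqueness identifies it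
        with \<open>f\<close>.\<close>
      have "f \<in> int_combs A" if f: "f \<in> L" for f
      proof -
        obtain g where g: "g \<in> L_P" "linked S P V_SP f g"
          using f sub1 LP by (auto simp: matched_comp_eq_linked)
        then obtain c where c: "g = int_comb c B"
          using B by (auto simp: basis_matrix_on_def int_combs_eq_range)
        have "f = int_comb c A"
          using uniq[OF f closed g(2)] linked_int_comb[OF V len AB] c by blast
        then show ?thesis
          by (simp add: int_comb_in_int_combs)
      qed
      then have "L = int_combs A"
        using closed by (auto simp: int_combs_eq_range)
      moreover have "set A \<subseteq> vec_on S"
        using A len LS by (force simp: in_set_conv_nth)
      ultimately show ?thesis
        using ind by (simp add: basis_matrix_on_def)
    qed
    \<comment> \<open>Both inclusions are hypotheses here, whereas above they came from the linked
      rows.\<close>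
    have "K_S = V_S + L"
      unfolding assms(8-10) by (rule matched_comp_sum[OF V disj WP LP sub1 sub2])
    then show ?thesis
      using a b by (auto simp: add.commute)
  qed

  show ?thesis
  proof (rule conjI[OF part1 conjI], goal_cases)
    case 1
    show ?case
      by (intro allI impI, rule conjI, erule exists, intro allI impI, elim conjE) (rule part2)
  next
    case 2
    show ?case
      by (intro allI impI, elim conjE) (rule part3)
  qed
qed

end
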